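(* Let $k$ be a positive integer, let $p\in[0,1]$, and let $C=1-p$. For $0\le i\le k$ let $$F(i;k,1-p)\triangleq\sum_{j=0}^{i}\binom{k}{j}(1-p)^{j}p^{k-j}$$ (with the convention $0^0=1$) be the CDF, evaluated at $i$, of a binomial distribution with $k$ trials and success probability $1-p$. Then $$kC+\sum_{i=0}^{k-1}\frac{2^k-1}{2^k-2^i}\,F(i;k,1-p)\;\le\; k+\sum_{i=1}^{k-1}\frac{2^i-1}{2^k-2^i}.$$ Moreover, equality holds if $p=1$ or $k=1$.
   Context: An empty sum (such as $\sum_{i=1}^{k-1}$ when $k=1$) equals $0$. The quantity $C=1-p$ is the capacity of the binary erasure channel with erasure probability $p$; no property of the channel is needed for the statement. *)

theory Defs
  imports Complex_Main
begin

text \<open>CDF at \<open>i\<close> of the binomial distribution with \<open>k\<close> trials and success probability \<open>q\<close>;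
  the convention \<open>0^0 = 1\<close> is that of the library power on \<^typ>\<open>nat\<close> exponents.\<close>

definition binomial_cdf :: "nat \<Rightarrow> nat \<Rightarrow> real \<Rightarrow> real" where
  "binomial_cdf i k q = (\<Sum>j=0..i. real (k choose j) * q ^ j * (1 - q) ^ (k - j))"

end

theory Submission imports Defs begin

text \<open>Write \<open>a i = (2^k - 1) / (2^k - 2^i)\<close>, so that \<open>a i - 1 = (2^i - 1) / (2^k - 2^i) \<ge> 0\<close>,
  with \<open>a 0 = 1\<close>. By the formula for the mean of the binomial distribution,
  the values \<open>F i\<close> of its CDF with \<open>i < k\<close> add up to \<open>k - k C\<close>. Hence the left-hand side equals
  \<open>k + (\<Sum>i<k. (a i - 1) * F i)\<close>, and the claim follows from \<open>F i \<le> 1\<close>.\<close>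

lemma binomial_cdf_le_1:
  assumes "i \<le> k" "0 \<le> q" "q \<le> 1"
  shows "binomial_cdf i k q \<le> 1"
proof -
  have "binomial_cdf i k q \<le> (\<Sum>j\<le>k. real (k choose j) * q ^ j * (1 - q) ^ (k - j))"
    unfolding binomial_cdf_def using assms by (intro sum_mono2) auto
  also have "\<dots> = (q + (1 - q)) ^ k"
    by (rule binomial_ring [symmetric])
  finally show ?thesis by simp
qed

text \<open>With success probability 0 all mass sits at 0. This settles the equality case
  \<open>p = 1\<close>.\<close>

lemma binomial_cdf_0 [simp]: "binomial_cdf i k 0 = 1"
  by (simp add: binomial_cdf_def sum.atLeast_Suc_atMost)

text \<open>The mass at \<open>j\<close> is counted once for each \<open>i\<close> with
  \<open>j \<le> i < k\<close>, that is \<open>k - j\<close> times, so the sum is the expected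
  number of failures. Absorbing the factor \<open>k - j\<close> into the binomial coefficient leaves
  the binomial theorem with exponent \<open>n = k - 1\<close>.\<close>

lemma sum_binomial_cdf:
  "(\<Sum>i<k. binomial_cdf i k q) = real k * (1 - q)"
proof (cases k)
  case (Suc n)
  define b where "b j = real (k choose j) * q ^ j * (1 - q) ^ (k - j)" for j
  have b: "real (k - j) * b j
      = real k * (1 - q) * (real (n choose j) * q ^ j * (1 - q) ^ (n - j))" if "j \<le> n" for j
  proof -
    have "(k - j) * (k choose j) = k * (n choose j)"
      using binomial_absorb_comp [of k j] Suc by simp
    then have "real (k - j) * real (k choose j) = real k * real (n choose j)"
      by (metis of_nat_mult)
    then have "real (k - j) * b j = real k * real (n choose j) * q ^ j * (1 - q) ^ (k - j)"
      by (simp only: b_def flip: mult.assoc)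
    \<comment> \<open>The bound \<open>j \<le> n\<close> matters: it gives
      \<open>k - j = Suc (n - j)\<close> despite truncated subtraction.\<close>
    moreover have "(1 - q) ^ (k - j) = (1 - q) * (1 - q) ^ (n - j)"
      using that by (simp add: Suc Suc_diff_le)
    ultimately show ?thesis
      by (simp only: mult_ac)
  qed
  \<comment> \<open>Both indices now range over \<open>{..<k}\<close> with the constraint
    \<open>j \<le> i\<close>, the form in which the sums can be swapped.\<close>
  have "(\<Sum>i<k. binomial_cdf i k q) = (\<Sum>i<k. \<Sum>j\<in>{j\<in>{..<k}. j \<le> i}. b j)"
    unfolding binomial_cdf_def b_def by (intro sum.cong) auto
  also have "\<dots> = (\<Sum>j<k. \<Sum>i\<in>{i\<in>{..<k}. j \<le> i}. b j)"
    by (rule sum.swap_restrict) auto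
  also have "\<dots> = (\<Sum>j<k. real (k - j) * b j)"
  proof (intro sum.cong refl)
    fix j
    have "{i\<in>{..<k}. j \<le> i} = {j..<k}" by auto
    then show "(\<Sum>i\<in>{i\<in>{..<k}. j \<le> i}. b j) = real (k - j) * b j" by simp
  qed
  also have "\<dots> = (\<Sum>j\<le>n. real k * (1 - q) * (real (n choose j) * q ^ j * (1 - q) ^ (n - j)))"
    using b by (intro sum.cong) (auto simp: Suc)
  also have "\<dots> = real k * (1 - q) * (q + (1 - q)) ^ n"
    by (simp only: binomial_ring sum_distrib_left)
  finally show ?thesis by simp
qed simp

theorem corollary1:
  fixes k :: nat and p C :: real
  assumes "k > 0" and "0 \<le> p" and "p \<le> 1" and "C = 1 - p"
  shows "(real k * C + (\<Sum>i=0..<k. (2 ^ k - 1) / (2 ^ k - 2 ^ i) * binomial_cdf i k (1 - p))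
            \<le> real k + (\<Sum>i=1..<k. (2 ^ i - 1) / (2 ^ k - 2 ^ i)))
       \<and> (p = 1 \<or> k = 1 \<longrightarrow>
          real k * C + (\<Sum>i=0..<k. (2 ^ k - 1) / (2 ^ k - 2 ^ i) * binomial_cdf i k (1 - p))
            = real k + (\<Sum>i=1..<k. (2 ^ i - 1) / (2 ^ k - 2 ^ i)))"
proof -
  define F where "F i = binomial_cdf i k (1 - p)" for i
  define d :: "nat \<Rightarrow> real" where "d i = (2 ^ i - 1) / (2 ^ k - 2 ^ i)" for i
  have lt: "(2::real) ^ i < 2 ^ k" if "i < k" for i
    using that by simp
  have d_nonneg: "0 \<le> d i" if "i < k" for i
    using lt [OF that] by (simp add: d_def)
  have coeff: "(2 ^ k - 1) / (2 ^ k - 2 ^ i) = 1 + d i" if "i < k" for i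
    using lt [OF that] by (simp add: d_def field_simps)
  have "(\<Sum>i=0..<k. (2 ^ k - 1) / (2 ^ k - 2 ^ i) * F i) = (\<Sum>i=0..<k. F i + d i * F i)"
    by (intro sum.cong) (auto simp: coeff algebra_simps)
  also have "\<dots> = real k * p + (\<Sum>i=0..<k. d i * F i)"
    using sum_binomial_cdf [of k "1 - p"] by (simp add: sum.distrib F_def atLeast0LessThan)
  \<comment> \<open>The term at 0 drops out because \<open>d 0 = 0\<close>.\<close>
  also have "(\<Sum>i=0..<k. d i * F i) = (\<Sum>i=1..<k. d i * F i)"
    using \<open>k > 0\<close> by (simp add: sum.atLeast_Suc_lessThan d_def)
  finally have lhs: "real k * C + (\<Sum>i=0..<k. (2 ^ k - 1) / (2 ^ k - 2 ^ i) * F i)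
      = real k + (\<Sum>i=1..<k. d i * F i)"
    by (simp add: \<open>C = 1 - p\<close> algebra_simps)
  have "(\<Sum>i=1..<k. d i * F i) \<le> (\<Sum>i=1..<k. d i)"
    using assms by (intro sum_mono mult_left_le) (auto simp: F_def d_nonneg intro: binomial_cdf_le_1)
  \<comment> \<open>For \<open>k = 1\<close> both sums are empty; for \<open>p = 1\<close> every
    \<open>F i\<close> is 1.\<close>
  moreover have "(\<Sum>i=1..<k. d i * F i) = (\<Sum>i=1..<k. d i)" if "p = 1 \<or> k = 1"
    using that by (auto simp: F_def)
  ultimately show ?thesis
    using lhs unfolding F_def d_def by simp
qed

end
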